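(* Let $a>0$, $n\ge1$, let $K$ be the Kasteleyn matrix of the Aztec diamond graph of order $n$, and let $K_n$ be the correlation kernel of the red--blue particle process (both as defined in the context). Then for all $(x_1,x_2)\in\mathtt W$ and $(y_1,y_2)\in\mathtt B$, $$K^{-1}\bigl((x_1,x_2),(y_1,y_2)\bigr)=-(-1)^{(x_1-x_2+y_1-y_2+2)/4}\,K_n\Bigl(y_2,\tfrac{y_2-y_1+1}{2};\;x_2,\tfrac{x_2-x_1+1}{2}\Bigr).$$
   Context: The Aztec diamond graph of order $n$ has white vertices $\mathtt W=\{(x_1,x_2)\in\mathbb Z^2: x_1 \text{ odd}, x_2\text{ even}, 1\le x_1\le 2n-1, 0\le x_2\le 2n\}$ and black vertices $\mathtt B=\{(x_1,x_2)\in\mathbb Z^2: x_1\text{ even}, x_2\text{ odd}, 0\le x_1\le 2n, 1\le x_2\le 2n-1\}$. Put $e_1=(1,1)$, $e_2=(-1,1)$; $b\in\mathtt B$ and $w\in\mathtt W$ are adjacent iff $w-b\in\{\pm e_1,\pm e_2\}$. The Kasteleyn matrix $K$ (rows indexed by $\mathtt B$, columns by $\mathtt W$) is, for $b=(b_1,b_2)\in\mathtt B$, $w\in\mathtt W$, $l\in\{0,1\}$: $K(b,w)=(-1)^{l+(b_1+b_2-1)/2}$ if $w=b+(-1)^le_1$; $K(b,w)=(-1)^{l+(b_1+b_2-1)/2}\,a\,i$ if $w=b-(-1)^le_2$; and $K(b,w)=0$ otherwise. $K^{-1}$ has rows indexed by $\mathtt W$ and columns by $\mathtt B$. Convention: for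 even integers $m$, $(-1)^{m/4}:=i^{m/2}$. The kernel $K_n$ is $K_n(u_1,u_2;v_1,v_2)=\widetilde K_n(u_1,u_2;v_1,v_2)-\phi_{u_1,v_1}(u_2,v_2)$, where, for $\varepsilon_1,\varepsilon_2\in\{0,1\}$ and integers $r,s,u_2,v_2$, $$\widetilde K_n(2r-\varepsilon_1,u_2;2s-\varepsilon_2,v_2)=\frac1{(2\pi i)^2}\int_{\gamma}\frac{dw}{w}\int_{\gamma'}\frac{dz}{z}\,\frac{z^{v_2}}{w^{u_2}}\,\frac{(1-az)^{n-s+\varepsilon_2}(1+a/z)^s}{(1-aw)^{n-r+\varepsilon_1}(1+a/w)^r}\,\frac{w}{w-z},$$ $$\phi_{2r-\varepsilon_1,2s-\varepsilon_2}(u_2,v_2)=\frac{\mathbb I(2r-\varepsilon_1<2s-\varepsilon_2)}{2\pi i}\int_{\gamma''}z^{v_2-u_2}\,\frac{(1-az)^{r-s+\varepsilon_2-\varepsilon_1}}{(1+a/z)^{r-s}}\,\frac{dz}{z}.$$ All contours are positively oriented simple closed curves: $\gamma'$ is a small circle around $0$; $\gamma$ encloses $0$, $-a$ and $\gamma'$ but not $1/a$; $\gamma''$ encloses $0$ but not $1/a$. (When $0<a<1$ one can take circles centred at $0$: $\gamma$ of radius $r_1$ with $a<r_1<1/a$, $\gamma'$ of radius $r_2$ with $0<r_2<r_1$, and $\gamma''$ of radius $1$.) *)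

theory Defs
  imports "HOL-Complex_Analysis.Complex_Analysis"
begin

type_synonym vertex = "int \<times> int"

definition white_vertices :: "nat \<Rightarrow> vertex set" where
  "white_vertices n =
     {(x1, x2). odd x1 \<and> even x2 \<and> 1 \<le> x1 \<and> x1 \<le> 2 * int n - 1 \<and> 0 \<le> x2 \<and> x2 \<le> 2 * int n}"

definition black_vertices :: "nat \<Rightarrow> vertex set" where
  "black_vertices n =
     {(x1, x2). even x1 \<and> odd x2 \<and> 0 \<le> x1 \<and> x1 \<le> 2 * int n \<and> 1 \<le> x2 \<and> x2 \<le> 2 * int n - 1}"

definition e1 :: vertex where "e1 = (1, 1)"
definition e2 :: vertex where "e2 = (-1, 1)"

text \<open>
  The sign $(-1)^{l + (b_1 + b_2 - 1)/2}$; on black vertices $b_1 + b_2 - 1$ is even, so the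
  integer division is exact.
\<close>

definition kasteleyn_sign :: "int \<Rightarrow> vertex \<Rightarrow> complex" where
  "kasteleyn_sign l b = (-1) powi (l + (fst b + snd b - 1) div 2)"

text \<open>
  The four nonzero cases are $w = b + (-1)^l e_1$ and $w = b - (-1)^l e_2$ for $l = 0, 1$.
\<close>

definition kasteleyn :: "real \<Rightarrow> vertex \<Rightarrow> vertex \<Rightarrow> complex" where
  "kasteleyn a b w =
     (if w = b + e1 then kasteleyn_sign 0 b
      else if w = b - e1 then kasteleyn_sign 1 b
      else if w = b - e2 then kasteleyn_sign 0 b * of_real a * \<i>
      else if w = b + e2 then kasteleyn_sign 1 b * of_real a * \<i>
      else 0)"

text \<open>
  Matrices with rows indexed by a finite set \<open>R\<close> and columns by a finite set \<open>C\<close>, and their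
  two-sided inverses, whose rows are indexed by \<open>C\<close> and columns by \<open>R\<close>. The inverse is a choice
  of two-sided inverse, as for the library's \<^const>\<open>matrix_inv\<close>; on \<open>C \<times> R\<close> it is determined
  as soon as a two-sided inverse exists.
\<close>

definition is_inverse_on ::
    "'r set \<Rightarrow> 'c set \<Rightarrow> ('r \<Rightarrow> 'c \<Rightarrow> complex) \<Rightarrow> ('c \<Rightarrow> 'r \<Rightarrow> complex) \<Rightarrow> bool" where
  "is_inverse_on R C M L \<longleftrightarrow>
     (\<forall>i\<in>R. \<forall>j\<in>R. (\<Sum>k\<in>C. M i k * L k j) = (if i = j then 1 else 0)) \<and>
     (\<forall>i\<in>C. \<forall>j\<in>C. (\<Sum>k\<in>R. L i k * M k j) = (if i = j then 1 else 0))"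

definition invertible_on :: "'r set \<Rightarrow> 'c set \<Rightarrow> ('r \<Rightarrow> 'c \<Rightarrow> complex) \<Rightarrow> bool" where
  "invertible_on R C M \<longleftrightarrow> (\<exists>L. is_inverse_on R C M L)"

definition matrix_inv_on ::
    "'r set \<Rightarrow> 'c set \<Rightarrow> ('r \<Rightarrow> 'c \<Rightarrow> complex) \<Rightarrow> 'c \<Rightarrow> 'r \<Rightarrow> complex" where
  "matrix_inv_on R C M = (SOME L. is_inverse_on R C M L)"

definition kasteleyn_inv :: "nat \<Rightarrow> real \<Rightarrow> vertex \<Rightarrow> vertex \<Rightarrow> complex" where
  "kasteleyn_inv n a = matrix_inv_on (black_vertices n) (white_vertices n) (kasteleyn a)"

text \<open>For even \<open>m\<close>, the convention $(-1)^{m/4} := i^{m/2}$.\<close>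

definition neg_one_pow_quarter :: "int \<Rightarrow> complex" where
  "neg_one_pow_quarter m = \<i> powi (m div 2)"

definition pos_simple_closed_curve :: "(real \<Rightarrow> complex) \<Rightarrow> bool" where
  "pos_simple_closed_curve \<gamma> \<longleftrightarrow>
     valid_path \<gamma> \<and> simple_path \<gamma> \<and> pathfinish \<gamma> = pathstart \<gamma> \<and>
     (\<forall>z\<in>inside (path_image \<gamma>). winding_number \<gamma> z = 1)"

text \<open>
  The contours \<open>\<gamma>\<close>, \<open>\<gamma>'\<close>, \<open>\<gamma>''\<close> (here \<open>\<gamma>\<close>, \<open>\<gamma>1\<close>, \<open>\<gamma>2\<close>). Not enclosing $1/a$ includes not passing
  through it. The smallness of the circle \<open>\<gamma>1\<close> is that \<open>\<gamma>\<close> encloses it.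
\<close>

definition admissible_contours ::
    "real \<Rightarrow> (real \<Rightarrow> complex) \<Rightarrow> (real \<Rightarrow> complex) \<Rightarrow> (real \<Rightarrow> complex) \<Rightarrow> bool" where
  "admissible_contours a \<gamma> \<gamma>1 \<gamma>2 \<longleftrightarrow>
     pos_simple_closed_curve \<gamma> \<and>
     0 \<in> inside (path_image \<gamma>) \<and> - of_real a \<in> inside (path_image \<gamma>) \<and>
     path_image \<gamma>1 \<subseteq> inside (path_image \<gamma>) \<and> of_real (1 / a) \<in> outside (path_image \<gamma>) \<and>
     (\<exists>\<delta>>0. \<gamma>1 = circlepath 0 \<delta>) \<and>
     pos_simple_closed_curve \<gamma>2 \<and>
     0 \<in> inside (path_image \<gamma>2) \<and> of_real (1 / a) \<in> outside (path_image \<gamma>2)"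

lemma pos_simple_closed_curve_circlepath:
  assumes "R > 0"
  shows "pos_simple_closed_curve (circlepath c R)"
    and "inside (path_image (circlepath c R)) = ball c R"
    and "outside (path_image (circlepath c R)) = - cball c R"
proof -
  have f: "path_image (circlepath c R) = frontier (cball c R)"
    using assms by simp
  show i: "inside (path_image (circlepath c R)) = ball c R"
    unfolding f by (subst inside_frontier_eq_interior) auto
  show "outside (path_image (circlepath c R)) = - cball c R"
    unfolding f using outside_frontier_eq_complement_closure[of "cball c R"] by auto
  show "pos_simple_closed_curve (circlepath c R)"
    unfolding pos_simple_closed_curve_def i using assms
    by (auto simp: simple_path_circlepath winding_number_circlepath dist_norm norm_minus_commute)
qed

text \<open>
  Admissible contours exist for every \<open>a > 0\<close>, also for \<open>a \<ge> 1\<close>, where \<open>\<gamma>\<close> cannot be a circle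
  centred at the origin.
\<close>

lemma admissible_contours_exist:
  assumes "a > 0"
  shows "\<exists>\<gamma> \<gamma>1 \<gamma>2. admissible_contours a \<gamma> \<gamma>1 \<gamma>2"
proof (intro exI)
  define R where "R = a + 1 / (2 * a)"
  define d where "d = 1 / (4 * a)"
  have pos: "R > 0" "d > 0" "a < R" "R = a + 2 * d" "1 / a = 4 * d"
    using assms by (auto simp: R_def d_def add_pos_pos)
  have 1: "of_real (1 / a) \<notin> cball (- of_real a :: complex) R"
  proof -
    have "dist (- of_real a :: complex) (of_real (1 / a)) = norm (of_real (a + 1 / a) :: complex)"
      by (subst norm_minus_cancel[symmetric]) (simp add: dist_norm add.commute)
    also have "\<dots> = a + 1 / a" using assms by (simp only: norm_of_real) simp
    finally show ?thesis using pos by simp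
  qed
  have 2: "of_real (1 / a) \<notin> cball (0 :: complex) d"
    using pos by simp
  have 3: "sphere (0 :: complex) d \<subseteq> ball (- of_real a) R"
  proof
    fix z :: complex assume "z \<in> sphere 0 d"
    then have "dist (- of_real a) z \<le> a + d"
      using norm_triangle_ineq[of z "of_real a"] assms by (simp add: dist_norm norm_minus_commute)
    with pos show "z \<in> ball (- of_real a) R" by simp
  qed
  show "admissible_contours a (circlepath (- of_real a) R) (circlepath 0 d) (circlepath 0 d)"
    unfolding admissible_contours_def
      pos_simple_closed_curve_circlepath(2,3)[OF pos(1)] pos_simple_closed_curve_circlepath(2,3)[OF pos(2)]
    using pos assms 1 2 3 by (auto intro: pos_simple_closed_curve_circlepath(1))
qed

text \<open>
  Every integer is uniquely $u = 2 r - \varepsilon$ with $\varepsilon \in \{0, 1\}$.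
\<close>

definition eps_part :: "int \<Rightarrow> int" where "eps_part u = u mod 2"
definition half_part :: "int \<Rightarrow> int" where "half_part u = (u + 1) div 2"

lemma half_part_eps_part: "2 * half_part u - eps_part u = u" "eps_part u \<in> {0, 1}"
  unfolding half_part_def eps_part_def by (simp_all, presburger+)

lemma half_part_eps_part_unique:
  assumes "e \<in> {0, 1}"
  shows "half_part (2 * r - e) = r" "eps_part (2 * r - e) = e"
  using assms unfolding half_part_def eps_part_def by (auto, presburger+)

definition kernel_tilde ::
    "real \<Rightarrow> nat \<Rightarrow> (real \<Rightarrow> complex) \<Rightarrow> (real \<Rightarrow> complex) \<Rightarrow> int \<Rightarrow> int \<Rightarrow> int \<Rightarrow> int \<Rightarrow> complex" where
  "kernel_tilde a n \<gamma> \<gamma>1 u1 u2 v1 v2 =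
     (let r = half_part u1; \<epsilon>1 = eps_part u1; s = half_part v1; \<epsilon>2 = eps_part v1;
          A = complex_of_real a; N = int n
      in 1 / (2 * of_real pi * \<i>)\<^sup>2 *
         contour_integral \<gamma> (\<lambda>w. 1 / w *
           contour_integral \<gamma>1 (\<lambda>z. 1 / z *
             (z powi v2 / w powi u2 *
              (((1 - A * z) powi (N - s + \<epsilon>2) * (1 + A / z) powi s) /
               ((1 - A * w) powi (N - r + \<epsilon>1) * (1 + A / w) powi r)) *
              (w / (w - z))))))"

definition kernel_phi ::
    "real \<Rightarrow> (real \<Rightarrow> complex) \<Rightarrow> int \<Rightarrow> int \<Rightarrow> int \<Rightarrow> int \<Rightarrow> complex" where
  "kernel_phi a \<gamma>2 u1 v1 u2 v2 =
     (let r = half_part u1; \<epsilon>1 = eps_part u1; s = half_part v1; \<epsilon>2 = eps_part v1;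
          A = complex_of_real a
      in (if u1 < v1 then 1 else 0) / (2 * of_real pi * \<i>) *
         contour_integral \<gamma>2 (\<lambda>z. z powi (v2 - u2) *
           ((1 - A * z) powi (r - s + \<epsilon>2 - \<epsilon>1) / (1 + A / z) powi (r - s)) * (1 / z)))"

definition corr_kernel ::
    "real \<Rightarrow> nat \<Rightarrow> (real \<Rightarrow> complex) \<Rightarrow> (real \<Rightarrow> complex) \<Rightarrow> (real \<Rightarrow> complex) \<Rightarrow>
     int \<Rightarrow> int \<Rightarrow> int \<Rightarrow> int \<Rightarrow> complex" where
  "corr_kernel a n \<gamma> \<gamma>1 \<gamma>2 u1 u2 v1 v2 = kernel_tilde a n \<gamma> \<gamma>1 u1 u2 v1 v2 - kernel_phi a \<gamma>2 u1 v1 u2 v2"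

end

theory Submission
  imports Defs "Jordan_Normal_Form.Determinant"
begin

text \<open>
  Extend the right-hand side to the white vertices just outside the diamond. It vanishes there: at
  $x_1 = -1$ because nothing in the $z$-integrals is singular at $0$, and at $x_1 = 2n + 1$ because
  the double integral then equals $\phi$. Hence the product of $K$ with it can be
  computed at every black vertex by the same local formula. On the integrand
  $z^{v}(1 - az)^{n-s}(1 + a/z)^s$ this local combination is identically $0$, so only the jump of the
  indicator in $\phi$ contributes, which gives the identity matrix. Since there are as many white
  as black vertices, the right inverse is the inverse.
\<close>

section \<open>Contour integrals\<close>

text \<open>For \<open>m \<noteq> 1\<close>, \<open>m = 0\<close> included, (z - c)^(1 - m) / (1 -
  m) is a single-valued primitive off \<open>c\<close>, so a closed path gives 0. For
  \<open>m = 1\<close> the integral defines the winding number.\<close>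

lemma has_contour_integral_inverse_power:
  fixes c :: complex
  assumes "valid_path g" "pathfinish g = pathstart g" "c \<notin> path_image g"
  shows "((\<lambda>z. 1 / (z - c) ^ m) has_contour_integral
           2 * of_real pi * \<i> * (if m = 1 then winding_number g c else 0)) g"
proof (cases "m = 1")
  case True
  with has_contour_integral_winding_number[OF assms(1,3)] show ?thesis by simp
next
  case False
  define k where "k = 1 - int m"
  have k: "of_int k \<noteq> (0 :: complex)" using False unfolding k_def of_int_eq_0_iff by simp
  have "((\<lambda>z. (z - c) powi k / of_int k) has_field_derivative 1 / (z - c) ^ m) (at z within - {c})"
    if "z \<in> - {c}" for z
  proof -
    have "((\<lambda>z. (z - c) powi k) has_field_derivative of_int k * (z - c) powi (k - 1) * 1) (at z within - {c})"
      using that by (intro DERIV_power_int derivative_eq_intros) (auto intro!: derivative_eq_intros)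
    moreover have "of_int k * (z - c) powi (k - 1) * 1 / of_int k = 1 / (z - c) ^ m"
      using k by (simp add: k_def power_int_minus divide_inverse)
    ultimately show ?thesis
      using DERIV_cdivide[of _ _ z "- {c}" "of_int k"] by metis
  qed
  from contour_integral_primitive[OF this assms(1)] assms(2,3) False show ?thesis
    by auto
qed

lemma contour_integrable_holomorphic_off_finite:
  fixes f :: "complex \<Rightarrow> complex"
  assumes "valid_path g" "finite S" "f holomorphic_on - S" "path_image g \<inter> S = {}"
  shows "f contour_integrable_on g"
  using assms by (intro contour_integrable_holomorphic_simple[of _ "- S"]) (auto simp: finite_imp_closed)

text \<open>The residue theorem on the whole plane. Two closed paths with equal winding numbers
  about the poles get equal integrals; this stands in for deforming contours.\<close>

lemma contour_integral_eq_residues: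
  fixes f :: "complex \<Rightarrow> complex"
  assumes "valid_path g" "pathfinish g = pathstart g" "finite S" "f holomorphic_on - S"
    and "path_image g \<inter> S = {}"
  shows "contour_integral g f = 2 * of_real pi * \<i> * (\<Sum>p\<in>S. winding_number g p * residue f p)"
proof -
  have "f holomorphic_on UNIV - S" using assms(4) by (simp add: Compl_eq_Diff_UNIV)
  from Residue_theorem[OF open_UNIV connected_UNIV assms(3) this assms(1,2)] assms(5)
  show ?thesis by (auto simp: mult.assoc)
qed

section \<open>Principal parts at the origin and the Cauchy integrals producing them\<close>

text \<open>The terms with negative powers in the Laurent polynomial p(w) / w^j.\<close>

definition principal_part :: "complex poly \<Rightarrow> nat \<Rightarrow> complex \<Rightarrow> complex" where
  "principal_part p j w = (\<Sum>i<j. coeff p i / w ^ (j - i))"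

lemma principal_part_0 [simp]: "principal_part p 0 w = 0"
  by (simp add: principal_part_def)

lemma principal_part_pCons_Suc:
  "principal_part (pCons c p) (Suc j) w = c / w ^ Suc j + principal_part p j w"
  by (simp add: principal_part_def sum.lessThan_Suc_shift del: sum.lessThan_Suc)

lemma principal_part_add: "principal_part (p + q) j w = principal_part p j w + principal_part q j w"
  by (simp add: principal_part_def add_divide_distrib sum.distrib)

lemma principal_part_smult: "principal_part (Polynomial.smult c p) j w = c * principal_part p j w"
  by (simp add: principal_part_def sum_distrib_left)

text \<open>Below degree \<open>j\<close>, every power of w in p(w) / w^j is negative, so truncation
  loses nothing.\<close>

lemma principal_part_degree_less:
  assumes "degree p < j" "w \<noteq> 0"
  shows "principal_part p j w = poly p w / w ^ j"
proof -
  have "poly p w = (\<Sum>i<j. coeff p i * w ^ i)"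
    unfolding poly_altdef using assms(1)
    by (intro sum.mono_neutral_left) (auto simp: coeff_eq_0)
  moreover have "c / w ^ (j - i) = c * w ^ i / w ^ j" if "i < j" for i c
    using that assms(2) by (simp add: power_diff)
  ultimately show ?thesis
    by (simp add: principal_part_def sum_divide_distrib)
qed

lemma holomorphic_on_principal_part: "principal_part p j holomorphic_on - {0}"
  unfolding principal_part_def by (intro holomorphic_intros) auto

text \<open>The pole at \<open>w\<close> lies outside the circle, so \<open>m = 0\<close> gives 0.
  The partial fraction 1/(z^(m+1) (w - z)) = (1/w) (1/z^(m+1) + 1/(z^m (w - z))) lowers
  \<open>m\<close> by one.\<close>

lemma has_contour_integral_cauchy_inverse_power:
  assumes "\<delta> > 0" "norm w > \<delta>"
  shows "((\<lambda>z. 1 / (z ^ m * (w - z))) has_contour_integral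
           2 * of_real pi * \<i> * (if m = 0 then 0 else 1 / w ^ m)) (circlepath 0 \<delta>)"
proof (induction m)
  case 0
  have "(\<lambda>z. 1 / (w - z)) holomorphic_on cball 0 \<delta>"
    using assms by (intro holomorphic_intros) auto
  then have "((\<lambda>z. 1 / (w - z)) has_contour_integral 0) (circlepath 0 \<delta>)"
    using assms(1)
    by (intro Cauchy_theorem_convex_simple[of _ "cball 0 \<delta>"]) auto
  then show ?case by simp
next
  case (Suc m)
  have w: "w \<noteq> 0" using assms by auto
  have "0 \<notin> path_image (circlepath 0 \<delta>)" using assms(1) by simp
  from has_contour_integral_inverse_power[OF _ _ this, of "Suc m"]
  have 1: "((\<lambda>z. 1 / z ^ Suc m) has_contour_integral
      2 * of_real pi * \<i> * (if m = 0 then 1 else 0)) (circlepath 0 \<delta>)"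
    using assms(1) by (cases "m = 0") (simp_all add: winding_number_circlepath_centre)
  from has_contour_integral_lmul[OF has_contour_integral_add[OF 1 Suc.IH], of "1 / w"]
  have "((\<lambda>z. 1 / w * (1 / z ^ Suc m + 1 / (z ^ m * (w - z)))) has_contour_integral
      2 * of_real pi * \<i> * (1 / w ^ Suc m)) (circlepath 0 \<delta>)"
    by (rule back_subst[of "\<lambda>x. (_ has_contour_integral x) _"]) (use w in \<open>auto simp: field_simps\<close>)
  moreover have "1 / w * (1 / z ^ Suc m + 1 / (z ^ m * (w - z))) = 1 / (z ^ Suc m * (w - z))"
    if "z \<in> path_image (circlepath 0 \<delta>)" for z
  proof -
    have "z \<noteq> 0" "w - z \<noteq> 0" using that assms by auto
    then show ?thesis using w by (simp add: divide_simps)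
  qed
  ultimately have "((\<lambda>z. 1 / (z ^ Suc m * (w - z))) has_contour_integral
      2 * of_real pi * \<i> * (1 / w ^ Suc m)) (circlepath 0 \<delta>)"
    by (rule has_contour_integral_eq)
  then show ?case by simp
qed

text \<open>The Cauchy kernel 1/(w - z), with w outside the circle, projects p(z) / z^j onto its
  negative powers. The induction writes p = c + z q, which splits off the pole of highest
  order.\<close>

lemma has_contour_integral_cauchy_poly:
  assumes "\<delta> > 0" "norm w > \<delta>"
  shows "((\<lambda>z. poly p z / (z ^ j * (w - z))) has_contour_integral
           2 * of_real pi * \<i> * principal_part p j w) (circlepath 0 \<delta>)"
proof (induction j arbitrary: p)
  case 0
  have "(\<lambda>z. poly p z / (w - z)) holomorphic_on cball 0 \<delta>"
    using assms by (intro holomorphic_intros) auto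
  then have "((\<lambda>z. poly p z / (w - z)) has_contour_integral 0) (circlepath 0 \<delta>)"
    using assms(1)
    by (intro Cauchy_theorem_convex_simple[of _ "cball 0 \<delta>"]) auto
  then show ?case by simp
next
  case (Suc j)
  obtain c q where p: "p = pCons c q" by (rule pCons_cases)
  from has_contour_integral_add[OF has_contour_integral_lmul[OF
      has_contour_integral_cauchy_inverse_power[OF assms, of "Suc j"], of c] Suc.IH[of q]]
  have "((\<lambda>z. c * (1 / (z ^ Suc j * (w - z))) + poly q z / (z ^ j * (w - z))) has_contour_integral
      2 * of_real pi * \<i> * principal_part p (Suc j) w) (circlepath 0 \<delta>)"
    by (rule back_subst[of "\<lambda>x. (_ has_contour_integral x) _"])
      (auto simp: p principal_part_pCons_Suc ring_distribs)
  moreover have "c * (1 / (z ^ Suc j * (w - z))) + poly q z / (z ^ j * (w - z)) =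
      poly p z / (z ^ Suc j * (w - z))" if "z \<in> path_image (circlepath 0 \<delta>)" for z
  proof -
    have "z \<noteq> 0" "w - z \<noteq> 0" using that assms by auto
    then show ?thesis by (simp add: p divide_simps)
  qed
  ultimately show ?case by (rule has_contour_integral_eq)
qed

section \<open>Rational integrands with two poles and decay at infinity\<close>

text \<open>The conditions on \<open>m\<close> and \<open>i\<close> say m + i \<ge> 2, so the
  integrand decays like z^(-2) and its residues at 0 and \<open>b\<close> cancel; equal winding
  numbers then give 0. Partial fractions lower m + i, so no residue has to be computed.\<close>

lemma has_contour_integral_two_poles:
  fixes b :: complex
  assumes g: "valid_path g" "pathfinish g = pathstart g" "0 \<notin> path_image g" "b \<notin> path_image g"
    and wn: "winding_number g 0 = winding_number g b" and "b \<noteq> 0" "m > 0 \<or> i > 1" "i > 0 \<or> m > 1"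
  shows "((\<lambda>z. 1 / (z ^ m * (z - b) ^ i)) has_contour_integral 0) g"
  using assms(7,8)
proof (induction "m + i" arbitrary: m i rule: less_induct)
  case less
  note P = has_contour_integral_inverse_power[OF g(1,2)]
  consider "m = 0" | "i = 0" | "m > 0" "i > 0" by auto
  then show ?case
  proof cases
    case 1
    then show ?thesis using P[OF g(4), of i] less.prems by simp
  next
    case 2
    then show ?thesis using P[OF g(3), of m] less.prems by simp
  next
    case 3
    define m' i' where "m' = m - 1" and "i' = i - 1"
    have mi: "m = Suc m'" "i = Suc i'" using 3 by (simp_all add: m'_def i'_def)
    have "((\<lambda>z. 1 / (z ^ m * (z - b) ^ i') - 1 / (z ^ m' * (z - b) ^ i)) has_contour_integral 0) g"
    \<comment> \<open>At m = i = 1 the two fractions are 1/(z - b) and 1/z up to order and sign.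
      Each alone gives 2 pi i times a winding number, and these agree. In all other cases both
      fractions satisfy the induction hypothesis.\<close>
    proof (cases "m' = 0 \<and> i' = 0")
      case True
      then show ?thesis
        using has_contour_integral_diff[OF P[OF g(3), of 1] P[OF g(4), of 1]] wn mi by simp
    next
      case False
      consider "m' = 0" "i' > 0" | "m' > 0" "i' = 0" | "m' > 0" "i' > 0" using False by auto
      then show ?thesis
        using has_contour_integral_diff[OF less.hyps[of m i'] less.hyps[of m' i]] mi
        by cases auto
    qed
    from has_contour_integral_lmul[OF this, of "- (1 / b)"]
    have "((\<lambda>z. - (1 / b) * (1 / (z ^ m * (z - b) ^ i') - 1 / (z ^ m' * (z - b) ^ i)))
            has_contour_integral 0) g" by simp
    moreover have "- (1 / b) * (1 / (z ^ m * (z - b) ^ i') - 1 / (z ^ m' * (z - b) ^ i)) =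
        1 / (z ^ m * (z - b) ^ i)" if "z \<in> path_image g" for z
    proof -
      have "z \<noteq> 0" "z - b \<noteq> 0" using that g by auto
      then show ?thesis using \<open>b \<noteq> 0\<close> unfolding mi by (simp add: divide_simps)
    qed
    ultimately show ?thesis by (rule has_contour_integral_eq)
  qed
qed

text \<open>The total decay m + i - k is still at least 2. Writing 1 + c z = c (z - b) + (1 + b c)
  removes one factor of the numerator and keeps the order at \<open>b\<close> above the remaining
  exponent.\<close>

lemma has_contour_integral_two_poles_power:
  fixes b :: complex
  assumes g: "valid_path g" "pathfinish g = pathstart g" "0 \<notin> path_image g" "b \<notin> path_image g"
    and wn: "winding_number g 0 = winding_number g b" and "b \<noteq> 0" "m > 0" "i > k"
  shows "((\<lambda>z. (1 + c * z) ^ k / (z ^ m * (z - b) ^ i)) has_contour_integral 0) g"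
  using assms(8)
proof (induction k arbitrary: i)
  case 0
  then show ?case using has_contour_integral_two_poles[OF assms(1-6), of m i] \<open>m > 0\<close> by simp
next
  case (Suc k)
  obtain i' where i: "i = Suc i'" using Suc.prems by (cases i) auto
  have "((\<lambda>z. c * ((1 + c * z) ^ k / (z ^ m * (z - b) ^ i')) +
      (1 + b * c) * ((1 + c * z) ^ k / (z ^ m * (z - b) ^ i))) has_contour_integral c * 0 + (1 + b * c) * 0) g"
    using Suc.prems i by (intro has_contour_integral_add has_contour_integral_lmul Suc.IH) auto
  moreover have "c * ((1 + c * z) ^ k / (z ^ m * (z - b) ^ i')) +
      (1 + b * c) * ((1 + c * z) ^ k / (z ^ m * (z - b) ^ i)) =
      (1 + c * z) ^ Suc k / (z ^ m * (z - b) ^ i)" if "z \<in> path_image g" for z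
  proof -
    have "z \<noteq> 0" "z - b \<noteq> 0" using that g by auto
    then show ?thesis unfolding i by (simp add: divide_simps) (simp add: algebra_simps)
  qed
  ultimately show ?case by (simp add: has_contour_integral_eq)
qed


section \<open>Reduction of the kernel\<close>

lemma power_int_diff_of_nat:
  "z \<noteq> 0 \<Longrightarrow> z powi (int m - int k) = z ^ m / (z ^ k :: 'a :: field)"
  by (simp add: power_int_diff)

text \<open>This is z^s times the factor (1 - az)^(n-s) (1 + a/z)^s of the double integral, a
  polynomial for \<open>s \<le> n\<close>.\<close>

definition dimer_poly :: "real \<Rightarrow> nat \<Rightarrow> nat \<Rightarrow> complex poly" where
  "dimer_poly a n s = [:1, - of_real a:] ^ (n - s) * [:of_real a, 1:] ^ s"

lemma poly_dimer_poly:
  "poly (dimer_poly a n s) z = (1 - of_real a * z) ^ (n - s) * (z + of_real a) ^ s"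
  by (simp add: dimer_poly_def algebra_simps)

lemma degree_dimer_poly: "s \<le> n \<Longrightarrow> degree (dimer_poly a n s) \<le> n"
proof -
  assume "s \<le> n"
  have "degree (dimer_poly a n s) \<le> (n - s) * degree [:1, - of_real a :: complex:] + s * degree [:of_real a, 1 :: complex:]"
    unfolding dimer_poly_def
    by (intro order.trans[OF degree_mult_le] add_mono order.trans[OF degree_power_le]) (simp_all add: mult.commute)
  also have "\<dots> \<le> (n - s) * 1 + s * 1" by (intro add_mono mult_left_mono) auto
  finally show ?thesis using \<open>s \<le> n\<close> by simp
qed

text \<open>For \<open>s < n\<close> consecutive polynomials p and q satisfy (1 - az) q = (z + a) p.
  Principal parts are linear, and a factor z in the polynomial lowers the pole order by one.\<close>

lemma principal_part_dimer_poly_Suc: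
  assumes "s < n"
  shows "principal_part (dimer_poly a n (Suc s)) (Suc k) w =
    principal_part (dimer_poly a n s) k w
    + of_real a * principal_part (dimer_poly a n (Suc s)) k w
    + of_real a * principal_part (dimer_poly a n s) (Suc k) w"
proof -
  define p q where "p = dimer_poly a n s" and "q = dimer_poly a n (Suc s)"
  define A where "A = complex_of_real a"
  have shift: "principal_part (pCons 0 p) (Suc k) w = principal_part p k w" for p
    by (simp add: principal_part_pCons_Suc)
  have "n - s = Suc (n - Suc s)" using assms by simp
  then have "[:1, - A:] * q = [:A, 1:] * p"
    unfolding p_def q_def dimer_poly_def A_def by (simp only: power_Suc mult_ac)
  then have "q + Polynomial.smult (- A) (pCons 0 q) = Polynomial.smult A p + pCons 0 p"
    by simp
  then have "principal_part (q + Polynomial.smult (- A) (pCons 0 q)) (Suc k) w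
      = principal_part (Polynomial.smult A p + pCons 0 p) (Suc k) w" by simp
  then show ?thesis
    unfolding principal_part_add principal_part_smult shift p_def q_def A_def by (simp add: algebra_simps)
qed

text \<open>What remains of the double integral as a function of w after the z-integral has produced
  a principal part.\<close>

definition tilde_integrand ::
    "real \<Rightarrow> nat \<Rightarrow> nat \<Rightarrow> nat \<Rightarrow> nat \<Rightarrow> nat \<Rightarrow> complex \<Rightarrow> complex" where
  "tilde_integrand a n s j r l w =
     principal_part (dimer_poly a n s) j w * w ^ l / ((1 - of_real a * w) ^ (n + 1 - r) * (w + of_real a) ^ r)"

text \<open>The truncated difference \<open>s - r\<close> is the true exponent for
  \<open>r \<le> s\<close>, the range in which \<open>phi_term\<close> integrates this
  function.\<close>

definition phi_integrand ::
    "real \<Rightarrow> nat \<Rightarrow> nat \<Rightarrow> nat \<Rightarrow> nat \<Rightarrow> complex \<Rightarrow> complex" where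
  "phi_integrand a s j r l z =
     z ^ l * (z + of_real a) ^ (s - r) / (z ^ j * (1 - of_real a * z) ^ (s - r + 1))"

text \<open>
  In the coordinates $x = (2j - 1, 2s)$, $y = (2l, 2r - 1)$ all exponents of the kernel become
  natural numbers. The values $j = 0$ and $j = n + 1$ are white vertices just outside the diamond.
\<close>

locale kernel_contours =
  fixes a :: real and n :: nat and \<gamma> \<gamma>1 \<gamma>2 :: "real \<Rightarrow> complex"
  assumes a_pos: "a > 0" and admissible: "admissible_contours a \<gamma> \<gamma>1 \<gamma>2"
begin

abbreviation A :: complex where "A \<equiv> of_real a"

definition tilde_term :: "nat \<Rightarrow> nat \<Rightarrow> nat \<Rightarrow> nat \<Rightarrow> complex" where
  "tilde_term s j r l = contour_integral \<gamma> (tilde_integrand a n s j r l) / (2 * of_real pi * \<i>)"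

text \<open>The condition \<open>r \<le> s\<close> is the indicator 2r - 1 < 2s of the
  kernel.\<close>

definition phi_term :: "nat \<Rightarrow> nat \<Rightarrow> nat \<Rightarrow> nat \<Rightarrow> complex" where
  "phi_term s j r l =
     (if r \<le> s then contour_integral \<gamma>2 (phi_integrand a s j r l) / (2 * of_real pi * \<i>) else 0)"

lemma A_nz: "A \<noteq> 0" using a_pos by simp

lemma curve_facts:
  assumes "pos_simple_closed_curve g"
  shows "valid_path g" "pathfinish g = pathstart g"
    and "p \<in> inside (path_image g) \<Longrightarrow> winding_number g p = 1 \<and> p \<notin> path_image g"
    and "p \<in> outside (path_image g) \<Longrightarrow> winding_number g p = 0 \<and> p \<notin> path_image g"
  using assms unfolding pos_simple_closed_curve_def
  by (auto simp: inside_def outside_def simple_path_imp_path winding_number_zero_in_outside)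

lemma \<gamma>: "pos_simple_closed_curve \<gamma>" and \<gamma>2: "pos_simple_closed_curve \<gamma>2"
  using admissible unfolding admissible_contours_def by auto

lemmas \<gamma>_path = curve_facts(1,2)[OF \<gamma>] and \<gamma>2_path = curve_facts(1,2)[OF \<gamma>2]

lemma winding:
  "winding_number \<gamma> 0 = 1" "0 \<notin> path_image \<gamma>"
  "winding_number \<gamma> (- A) = 1" "- A \<notin> path_image \<gamma>"
  "winding_number \<gamma> (1 / A) = 0" "1 / A \<notin> path_image \<gamma>"
  "winding_number \<gamma>2 0 = 1" "0 \<notin> path_image \<gamma>2"
  "winding_number \<gamma>2 (1 / A) = 0" "1 / A \<notin> path_image \<gamma>2"
  using admissible curve_facts(3,4)[OF \<gamma>] curve_facts(3,4)[OF \<gamma>2]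
  unfolding admissible_contours_def by auto

lemma one_minus_A_mult_eq_0_iff: "1 - A * w = 0 \<longleftrightarrow> w = 1 / A"
  using A_nz by (auto simp: field_simps)

lemma \<gamma>_nz:
  assumes "w \<in> path_image \<gamma>"
  shows "w \<noteq> 0" "w + A \<noteq> 0" "1 - A * w \<noteq> 0"
  using assms winding unfolding one_minus_A_mult_eq_0_iff by (auto simp: add_eq_0_iff2)

lemma \<gamma>2_nz:
  assumes "w \<in> path_image \<gamma>2"
  shows "w \<noteq> 0" "1 - A * w \<noteq> 0"
  using assms winding unfolding one_minus_A_mult_eq_0_iff by auto

text \<open>Admissibility puts the circle inside \<gamma>; the Cauchy integral needs \<gamma> beyond
  the circle. As \<gamma> is connected and misses the circle, meeting the open disc would trap it
  there, and then the circle would lie outside \<gamma>.\<close>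

lemma \<gamma>1_circle:
  obtains \<delta> where "\<delta> > 0" "\<gamma>1 = circlepath 0 \<delta>" "\<And>w. w \<in> path_image \<gamma> \<Longrightarrow> norm w > \<delta>"
proof -
  obtain \<delta> where \<delta>: "\<delta> > 0" "\<gamma>1 = circlepath 0 \<delta>" "path_image \<gamma>1 \<subseteq> inside (path_image \<gamma>)"
    using admissible unfolding admissible_contours_def by auto
  then have sph: "sphere 0 \<delta> \<subseteq> inside (path_image \<gamma>)" by simp
  have "norm w > \<delta>" if w: "w \<in> path_image \<gamma>" for w
  proof (rule ccontr)
    assume "\<not> norm w > \<delta>"
    have conn: "connected (path_image \<gamma>)"
      using \<gamma>_path(1) by (simp add: connected_path_image valid_path_imp_path)
    have disj: "path_image \<gamma> \<inter> sphere 0 \<delta> = {}"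
      using sph inside_no_overlap[of "path_image \<gamma>"] by blast
    then have wb: "w \<in> ball 0 \<delta>" using w \<open>\<not> norm w > \<delta>\<close> by force
    have "path_image \<gamma> \<subseteq> ball 0 \<delta>"
    proof (rule ccontr)
      assume "\<not> path_image \<gamma> \<subseteq> ball 0 \<delta>"
      then have "path_image \<gamma> \<inter> frontier (ball 0 \<delta>) \<noteq> {}"
        using conn w wb by (intro connected_Int_frontier) auto
      then show False using disj \<delta>(1) by (simp add: frontier_ball)
    qed
    then have "- ball 0 \<delta> \<subseteq> outside (path_image \<gamma>)"
      by (intro outside_subset_convex) auto
    moreover have "of_real \<delta> \<in> - ball (0::complex) \<delta>" "of_real \<delta> \<in> sphere (0::complex) \<delta>"
      using \<delta>(1) by auto
    ultimately show False
      using sph inside_Int_outside[of "path_image \<gamma>"] by blast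
  qed
  with \<delta>(1,2) show ?thesis by (rule that)
qed

lemma tilde_integrand_integrable: "tilde_integrand a n s j r l contour_integrable_on \<gamma>"
proof (rule contour_integrable_holomorphic_off_finite[of _ "{0, - A, 1 / A}"])
  show "tilde_integrand a n s j r l holomorphic_on - {0, - A, 1 / A}"
    unfolding tilde_integrand_def
    by (intro holomorphic_intros holomorphic_on_subset[OF holomorphic_on_principal_part])
      (use A_nz in \<open>auto simp: add_eq_0_iff2 eq_divide_eq mult.commute\<close>)
qed (use \<gamma>_path winding in auto)

lemma phi_integrand_holomorphic: "phi_integrand a s j r l holomorphic_on - {0, 1 / A}"
  unfolding phi_integrand_def
  by (intro holomorphic_intros) (use A_nz in \<open>auto simp: eq_divide_eq mult.commute\<close>)

lemma phi_integrand_integrable: "phi_integrand a s j r l contour_integrable_on \<gamma>2"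
  by (rule contour_integrable_holomorphic_off_finite[OF _ _ phi_integrand_holomorphic])
    (use \<gamma>2_path winding in auto)

section \<open>The kernel integrals in lattice coordinates\<close>

text \<open>For fixed w on \<gamma> the z-integral is a Cauchy integral over a circle not enclosing
  w. It supplies one factor 2 pi i, and the numerator of w/(w - z) cancels the outer 1/w.\<close>

lemma kernel_tilde_eq:
  assumes "1 \<le> r" "r \<le> n" "s \<le> n"
  shows "kernel_tilde a n \<gamma> \<gamma>1 (2 * int r - 1) (int r - int l) (2 * int s) (int s - int j + 1)
    = tilde_term s j r l"
proof -
  obtain \<delta> where \<delta>: "\<delta> > 0" "\<gamma>1 = circlepath 0 \<delta>" "\<And>w. w \<in> path_image \<gamma> \<Longrightarrow> norm w > \<delta>"
    using \<gamma>1_circle by blast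
  have parts: "half_part (2 * int r - 1) = int r" "eps_part (2 * int r - 1) = 1"
    "half_part (2 * int s) = int s" "eps_part (2 * int s) = 0"
    using half_part_eps_part_unique[of 1 "int r"] half_part_eps_part_unique[of 0 "int s"] by auto
  define T where "T = (\<lambda>w z. 1 / z * (z powi (int s - int j + 1) / w powi (int r - int l) *
      (((1 - A * z) powi (int n - int s + 0) * (1 + A / z) powi int s) /
       ((1 - A * w) powi (int n - int r + 1) * (1 + A / w) powi int r)) * (w / (w - z))))"
  have inner: "contour_integral \<gamma>1 (T w) =
      w * (2 * of_real pi * \<i> * tilde_integrand a n s j r l w)" if w: "w \<in> path_image \<gamma>" for w
  proof -
    define c where "c = w * w ^ l / ((1 - A * w) ^ (n + 1 - r) * (w + A) ^ r)"
    have "((\<lambda>z. c * (poly (dimer_poly a n s) z / (z ^ j * (w - z)))) has_contour_integral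
        c * (2 * of_real pi * \<i> * principal_part (dimer_poly a n s) j w)) \<gamma>1"
      unfolding \<delta>(2) by (intro has_contour_integral_lmul has_contour_integral_cauchy_poly \<delta> w)
    moreover have "c * (poly (dimer_poly a n s) z / (z ^ j * (w - z))) = T w z"
      if z: "z \<in> path_image \<gamma>1" for z
    proof -
      have zw: "z \<noteq> 0" "w - z \<noteq> 0" using z \<delta>(1,2) \<delta>(3)[OF w] by auto
      note nz = zw \<gamma>_nz[OF w]
      have "int s - int j + 1 = int (Suc s) - int j" by simp
      then have "z powi (int s - int j + 1) = z powi (int (Suc s) - int j)"
        by (rule arg_cong)
      \<comment> \<open>The factor z cancels 1/z and z^s cancels the denominator of (1 + a/z)^s,
        leaving exactly a pole of order \<open>j\<close>.\<close>
      then have e1: "z powi (int s - int j + 1) = z * z ^ s / z ^ j"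
        unfolding power_int_diff_of_nat[OF nz(1)] by simp
      have e2: "w powi (int r - int l) = w ^ r / w ^ l"
        by (rule power_int_diff_of_nat[OF nz(3)])
      have "int n - int s + 0 = int (n - s)" using assms by simp
      then have e3: "(1 - A * z) powi (int n - int s + 0) = (1 - A * z) ^ (n - s)"
        by (simp only: power_int_of_nat)
      have "int n - int r + 1 = int (n + 1 - r)" using assms by simp
      then have e4: "(1 - A * w) powi (int n - int r + 1) = (1 - A * w) ^ (n + 1 - r)"
        by (simp only: power_int_of_nat)
      have "1 + A / z = (z + A) / z" "1 + A / w = (w + A) / w" using nz by (simp_all add: field_simps)
      then have e5: "(1 + A / z) powi int s = (z + A) ^ s / z ^ s"
        "(1 + A / w) powi int r = (w + A) ^ r / w ^ r" by (simp_all add: power_divide)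
      show ?thesis
        unfolding T_def e1 e2 e3 e4 e5 c_def poly_dimer_poly using nz by (simp add: divide_simps)
    qed
    ultimately have "(T w has_contour_integral
        c * (2 * of_real pi * \<i> * principal_part (dimer_poly a n s) j w)) \<gamma>1"
      by (rule has_contour_integral_eq)
    then show ?thesis
      by (simp add: contour_integral_unique c_def tilde_integrand_def mult_ac)
  qed
  have "((\<lambda>w. 2 * of_real pi * \<i> * tilde_integrand a n s j r l w) has_contour_integral
      2 * of_real pi * \<i> * contour_integral \<gamma> (tilde_integrand a n s j r l)) \<gamma>"
    by (intro has_contour_integral_lmul has_contour_integral_integral tilde_integrand_integrable)
  moreover have "2 * of_real pi * \<i> * tilde_integrand a n s j r l w = 1 / w * contour_integral \<gamma>1 (T w)"
    if "w \<in> path_image \<gamma>" for w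
    using inner[OF that] \<gamma>_nz[OF that] by simp
  ultimately have "((\<lambda>w. 1 / w * contour_integral \<gamma>1 (T w)) has_contour_integral
      2 * of_real pi * \<i> * contour_integral \<gamma> (tilde_integrand a n s j r l)) \<gamma>"
    by (rule has_contour_integral_eq)
  then have "contour_integral \<gamma> (\<lambda>w. 1 / w * contour_integral \<gamma>1 (T w)) =
      2 * of_real pi * \<i> * contour_integral \<gamma> (tilde_integrand a n s j r l)"
    by (rule contour_integral_unique)
  then show ?thesis
    unfolding kernel_tilde_def Let_def parts T_def tilde_term_def by (simp add: power2_eq_square)
qed

lemma kernel_phi_eq:
  "kernel_phi a \<gamma>2 (2 * int r - 1) (2 * int s) (int r - int l) (int s - int j + 1) = phi_term s j r l"
proof (cases "r \<le> s")
  case False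
  then show ?thesis by (simp add: kernel_phi_def phi_term_def)
next
  case True
  have parts: "half_part (2 * int r - 1) = int r" "eps_part (2 * int r - 1) = 1"
    "half_part (2 * int s) = int s" "eps_part (2 * int s) = 0"
    using half_part_eps_part_unique[of 1 "int r"] half_part_eps_part_unique[of 0 "int s"] by auto
  obtain d where s: "s = r + d" using True by (auto simp: le_iff_add)
  have "z powi (int s - int j + 1 - (int r - int l)) *
      ((1 - A * z) powi (int r - int s + 0 - 1) / (1 + A / z) powi (int r - int s)) * (1 / z)
      = phi_integrand a s j r l z" if "z \<in> path_image \<gamma>2" for z
  proof -
    note nz = \<gamma>2_nz[OF that]
    have "int s - int j + 1 - (int r - int l) = int (Suc d + l) - int j" by (simp add: s)
    then have "z powi (int s - int j + 1 - (int r - int l)) = z powi (int (Suc d + l) - int j)"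
      by (rule arg_cong)
    also have "\<dots> = z * z ^ d * z ^ l / z ^ j"
      unfolding power_int_diff_of_nat[OF nz(1)] by (simp add: power_add)
    finally have e1: "z powi (int s - int j + 1 - (int r - int l)) = z * z ^ d * z ^ l / z ^ j" .
    \<comment> \<open>The extra 1 comes from the odd first argument 2r - 1, and explains the
      exponent \<open>s - r + 1\<close> in \<open>phi_integrand\<close>.\<close>
    have "int r - int s + 0 - 1 = - int (Suc d)" by (simp add: s)
    then have e2: "(1 - A * z) powi (int r - int s + 0 - 1) = 1 / (1 - A * z) ^ Suc d"
      by (simp only: power_int_minus power_int_of_nat inverse_eq_divide)
    have "int r - int s = - int d" by (simp add: s)
    then have "(1 + A / z) powi (int r - int s) = 1 / (1 + A / z) ^ d"
      by (simp only: power_int_minus power_int_of_nat inverse_eq_divide)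
    moreover have "1 + A / z = (z + A) / z" using nz by (simp add: field_simps)
    ultimately have e3: "(1 + A / z) powi (int r - int s) = 1 / ((z + A) ^ d / z ^ d)"
      by (simp only: power_divide)
    show ?thesis
      unfolding e1 e2 e3 phi_integrand_def using nz by (simp add: s field_simps)
  qed
  then show ?thesis
    using True unfolding kernel_phi_def Let_def parts phi_term_def
    by (simp cong: contour_integral_cong)
qed


section \<open>Boundary values at j = 0 and j = n + 1\<close>

lemma tilde_term_0: "tilde_term s 0 r l = 0"
proof -
  have "tilde_integrand a n s 0 r l = (\<lambda>_. 0)" by (simp add: tilde_integrand_def fun_eq_iff)
  then show ?thesis by (simp add: tilde_term_def)
qed

text \<open>Without the factor z^(-j) the only possible pole is 1/a, around which \<gamma>2 does not
  wind.\<close>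

lemma phi_term_0: "phi_term s 0 r l = 0"
proof -
  have "phi_integrand a s 0 r l holomorphic_on - {1 / A}"
    unfolding phi_integrand_def
    by (intro holomorphic_intros) (use A_nz in \<open>auto simp: eq_divide_eq mult.commute\<close>)
  from contour_integral_eq_residues[OF \<gamma>2_path _ this] winding show ?thesis
    by (simp add: phi_term_def)
qed

text \<open>
  For \<open>j = n + 1\<close> the principal part is the whole Laurent polynomial, so the double integral
  collapses to a single one, with the integrand of \<open>\<phi>\<close> if \<open>r \<le> s\<close>, and with a pole at \<open>- a\<close> but
  none outside \<open>\<gamma>\<close> if \<open>r > s\<close>.
\<close>

lemma tilde_term_Suc_n:
  assumes "r \<le> n" "s \<le> n" "l \<le> n"
  shows "tilde_term s (Suc n) r l = phi_term s (Suc n) r l"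
proof -
  have pp: "principal_part (dimer_poly a n s) (Suc n) w =
      (1 - A * w) ^ (n - s) * (w + A) ^ s / w ^ Suc n" if "w \<in> path_image \<gamma>" for w
    using principal_part_degree_less[of "dimer_poly a n s" "Suc n" w] degree_dimer_poly[OF assms(2), of a]
      \<gamma>_nz[OF that] by (simp add: poly_dimer_poly)
  show ?thesis
  proof (cases "r \<le> s")
    case True
    have "tilde_integrand a n s (Suc n) r l w = phi_integrand a s (Suc n) r l w"
      if w: "w \<in> path_image \<gamma>" for w
    proof -
      note nz = \<gamma>_nz[OF w]
      have "n + 1 - r = (n - s) + (s - r + 1)" using assms True by simp
      then have e1: "(1 - A * w) ^ (n + 1 - r) = (1 - A * w) ^ (n - s) * (1 - A * w) ^ (s - r + 1)"
        by (simp only: power_add)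
      have "s = r + (s - r)" using True by simp
      then have e2: "(w + A) ^ s = (w + A) ^ r * (w + A) ^ (s - r)"
        by (metis power_add)
      show ?thesis
        unfolding tilde_integrand_def phi_integrand_def pp[OF w] e1 e2 using nz by (simp add: field_simps)
    qed
    then have "contour_integral \<gamma> (tilde_integrand a n s (Suc n) r l)
        = contour_integral \<gamma> (phi_integrand a s (Suc n) r l)"
      by (intro contour_integral_cong) auto
    \<comment> \<open>The pole at -a has cancelled, and both contours wind once around 0 and not
      around 1/a.\<close>
    also have "\<dots> = contour_integral \<gamma>2 (phi_integrand a s (Suc n) r l)"
      using contour_integral_eq_residues[OF \<gamma>_path _ phi_integrand_holomorphic, of s "Suc n" r l]
        contour_integral_eq_residues[OF \<gamma>2_path _ phi_integrand_holomorphic, of s "Suc n" r l] winding A_nz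
      by simp
    finally show ?thesis using True by (simp add: tilde_term_def phi_term_def)
  next
    case False
    \<comment> \<open>The factors 1 - aw now stay in the numerator, so 1/a is no pole. Both poles 0
      and -a lie inside \<gamma>, and \<open>l \<le> n\<close> gives the pole at 0 order at least
      1.\<close>
    have "((\<lambda>w. (1 + (- A) * w) ^ (r - s - 1) / (w ^ (Suc n - l) * (w - (- A)) ^ (r - s)))
        has_contour_integral 0) \<gamma>"
      using winding A_nz False assms
      by (intro has_contour_integral_two_poles_power \<gamma>_path) auto
    moreover have "(1 + (- A) * w) ^ (r - s - 1) / (w ^ (Suc n - l) * (w - (- A)) ^ (r - s)) =
        tilde_integrand a n s (Suc n) r l w" if w: "w \<in> path_image \<gamma>" for w
    proof -
      note nz = \<gamma>_nz[OF w]
      have "n - s = (n + 1 - r) + (r - s - 1)" using assms False by simp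
      then have e1: "(1 - A * w) ^ (n - s) = (1 - A * w) ^ (n + 1 - r) * (1 - A * w) ^ (r - s - 1)"
        by (simp only: power_add)
      have "r = s + (r - s)" using False by simp
      then have e2: "(w + A) ^ r = (w + A) ^ s * (w + A) ^ (r - s)"
        by (metis power_add)
      have "Suc n = (Suc n - l) + l" using assms by simp
      then have e3: "w ^ Suc n = w ^ (Suc n - l) * w ^ l" by (metis power_add)
      have e4: "1 + (- A) * w = 1 - A * w" "w - (- A) = w + A" by simp_all
      show ?thesis
        unfolding tilde_integrand_def pp[OF w] e1 e2 e3 e4 using nz by (simp add: field_simps)
    qed
    ultimately have "(tilde_integrand a n s (Suc n) r l has_contour_integral 0) \<gamma>"
      by (rule has_contour_integral_eq)
    then show ?thesis using False by (simp add: tilde_term_def phi_term_def contour_integral_unique)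
  qed
qed

section \<open>Local recurrences around a black vertex\<close>

text \<open>Only the principal part in the integrand depends on \<open>s\<close> and
  \<open>k\<close>, so the combination vanishes pointwise by
  \<open>principal_part_dimer_poly_Suc\<close>.\<close>

lemma tilde_term_recurrence:
  assumes "s < n"
  shows "tilde_term (Suc s) (Suc k) r l - tilde_term s k r l
    - A * tilde_term (Suc s) k r l - A * tilde_term s (Suc k) r l = 0"
proof -
  let ?f = "\<lambda>s k. tilde_integrand a n s k r l"
  have int: "(?f s k has_contour_integral contour_integral \<gamma> (?f s k)) \<gamma>" for s k
    by (intro has_contour_integral_integral tilde_integrand_integrable)
  have "((\<lambda>w. ?f (Suc s) (Suc k) w - ?f s k w - A * ?f (Suc s) k w - A * ?f s (Suc k) w) has_contour_integral
      contour_integral \<gamma> (?f (Suc s) (Suc k)) - contour_integral \<gamma> (?f s k)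
      - A * contour_integral \<gamma> (?f (Suc s) k) - A * contour_integral \<gamma> (?f s (Suc k))) \<gamma>"
    by (intro has_contour_integral_diff has_contour_integral_lmul int)
  moreover have "?f (Suc s) (Suc k) w - ?f s k w - A * ?f (Suc s) k w - A * ?f s (Suc k) w = 0" for w
    unfolding tilde_integrand_def principal_part_dimer_poly_Suc[OF assms]
    by (simp add: add_divide_distrib ring_distribs)
  ultimately have "contour_integral \<gamma> (?f (Suc s) (Suc k)) - contour_integral \<gamma> (?f s k)
      - A * contour_integral \<gamma> (?f (Suc s) k) - A * contour_integral \<gamma> (?f s (Suc k)) = 0"
    by (metis (no_types, lifting) has_contour_integral_eq has_contour_integral_0 has_contour_integral_unique)
  then show ?thesis
    unfolding tilde_term_def times_divide_eq_right diff_divide_distrib[symmetric] by simp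
qed

text \<open>For r > s + 1 all four indicators are off, and for \<open>r \<le> s\<close> all are on
  and the integrands cancel. At r = s + 1 only the two terms with first index s + 1 survive, and
  their combination is the integral of w^(l - k - 1).\<close>

lemma phi_term_recurrence:
  "phi_term (Suc s) (Suc k) r l - phi_term s k r l
    - A * phi_term (Suc s) k r l - A * phi_term s (Suc k) r l = (if r = Suc s \<and> l = k then 1 else 0)"
proof -
  let ?f = "\<lambda>s k. phi_integrand a s k r l"
  have int: "(?f s k has_contour_integral contour_integral \<gamma>2 (?f s k)) \<gamma>2" for s k
    by (intro has_contour_integral_integral phi_integrand_integrable)
  consider "r > Suc s" | "r \<le> s" | "r = Suc s" by linarith
  then show ?thesis
  proof cases
    case 1
    then show ?thesis by (simp add: phi_term_def)
  next
    case 2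
    have "((\<lambda>w. ?f (Suc s) (Suc k) w - ?f s k w - A * ?f (Suc s) k w - A * ?f s (Suc k) w) has_contour_integral
        contour_integral \<gamma>2 (?f (Suc s) (Suc k)) - contour_integral \<gamma>2 (?f s k)
        - A * contour_integral \<gamma>2 (?f (Suc s) k) - A * contour_integral \<gamma>2 (?f s (Suc k))) \<gamma>2"
      by (intro has_contour_integral_diff has_contour_integral_lmul int)
    moreover have "?f (Suc s) (Suc k) w - ?f s k w - A * ?f (Suc s) k w - A * ?f s (Suc k) w = 0"
      if "w \<in> path_image \<gamma>2" for w
    proof -
      define q where "q = 1 - A * w"
      have nz: "w \<noteq> 0" "q \<noteq> 0" using \<gamma>2_nz[OF that] by (auto simp: q_def)
      have fq: "phi_integrand a s k r l w = w ^ l * (w + A) ^ (s - r) / (w ^ k * q ^ (s - r + 1))" for s k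
        by (simp add: phi_integrand_def q_def)
      \<comment> \<open>Raising \<open>k\<close> divides by w; raising \<open>s\<close> multiplies
        by (w + a)/(1 - aw), because \<open>r \<le> s\<close> makes the truncated exponents grow by
        one.\<close>
      have f: "?f s (Suc k) w = ?f s k w / w" "?f (Suc s) k w = ?f s k w * ((w + A) / q)"
        "?f (Suc s) (Suc k) w = ?f s k w * ((w + A) / (w * q))"
        using 2 nz unfolding fq by (simp_all add: Suc_diff_le mult_ac)
      have "(w + A) / (w * q) - 1 - A * ((w + A) / q) - A / w = ((w + A) * (1 - A * w) - q * (w + A)) / (w * q)"
        using nz by (simp add: divide_simps) (simp add: algebra_simps)
      also have "\<dots> = 0" by (simp add: q_def)
      finally have "?f s k w * ((w + A) / (w * q) - 1 - A * ((w + A) / q) - A / w) = 0" by simp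
      then show ?thesis unfolding f by (simp add: ring_distribs mult_ac)
    qed
    ultimately have "contour_integral \<gamma>2 (?f (Suc s) (Suc k)) - contour_integral \<gamma>2 (?f s k)
        - A * contour_integral \<gamma>2 (?f (Suc s) k) - A * contour_integral \<gamma>2 (?f s (Suc k)) = 0"
      by (metis (no_types, lifting) has_contour_integral_eq has_contour_integral_0 has_contour_integral_unique)
    then show ?thesis
      using 2 by (simp add: phi_term_def flip: diff_divide_distrib)
  next
    case 3
    have "((\<lambda>w. ?f r (Suc k) w - A * ?f r k w) has_contour_integral
        contour_integral \<gamma>2 (?f r (Suc k)) - A * contour_integral \<gamma>2 (?f r k)) \<gamma>2"
      by (intro has_contour_integral_diff has_contour_integral_lmul int)
    moreover have "?f r (Suc k) w - A * ?f r k w = w ^ l / w ^ Suc k" if "w \<in> path_image \<gamma>2" for w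
    proof -
      define q where "q = 1 - A * w"
      have nz: "w \<noteq> 0" "q \<noteq> 0" using \<gamma>2_nz[OF that] by (auto simp: q_def)
      have fq: "phi_integrand a r k r l w = w ^ l / (w ^ k * q)" for k
        by (simp add: phi_integrand_def q_def)
      have f: "?f r (Suc k) w = w ^ l / w ^ Suc k / q" "?f r k w = w ^ l / w ^ Suc k * (w / q)"
        using nz unfolding fq by (simp_all add: divide_simps)
      have "?f r (Suc k) w - A * ?f r k w = w ^ l / w ^ Suc k * ((1 - A * w) / q)"
        unfolding f by (simp add: field_simps diff_divide_distrib)
      then show ?thesis using nz by (simp add: q_def)
    qed
    ultimately have 1: "((\<lambda>w. w ^ l / w ^ Suc k) has_contour_integral
        contour_integral \<gamma>2 (?f r (Suc k)) - A * contour_integral \<gamma>2 (?f r k)) \<gamma>2"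
      by (rule has_contour_integral_eq)
    have "((\<lambda>w. w ^ l / w ^ Suc k) has_contour_integral 2 * of_real pi * \<i> * (if l = k then 1 else 0)) \<gamma>2"
    \<comment> \<open>For \<open>l \<le> k\<close> there is a pole at 0, simple exactly when l = k;
      for l > k the integrand is a polynomial on the path.\<close>
    proof (cases "l \<le> k")
      case True
      have "((\<lambda>w. 1 / (w - 0) ^ (Suc k - l)) has_contour_integral
          2 * of_real pi * \<i> * (if Suc k - l = 1 then winding_number \<gamma>2 0 else 0)) \<gamma>2"
        by (intro has_contour_integral_inverse_power \<gamma>2_path winding)
      moreover have "1 / (w - 0) ^ (Suc k - l) = w ^ l / w ^ Suc k" if "w \<in> path_image \<gamma>2" for w
        using \<gamma>2_nz[OF that] True by (simp add: power_diff field_simps del: power_Suc)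
      ultimately have "((\<lambda>w. w ^ l / w ^ Suc k) has_contour_integral
          2 * of_real pi * \<i> * (if Suc k - l = 1 then winding_number \<gamma>2 0 else 0)) \<gamma>2"
        by (rule has_contour_integral_eq)
      moreover have "Suc k - l = 1 \<longleftrightarrow> l = k" using True by auto
      ultimately show ?thesis by (simp only: winding)
    next
      case False
      have "((\<lambda>w. w ^ (l - Suc k)) has_contour_integral 0) \<gamma>2"
        using \<gamma>2_path by (intro Cauchy_theorem_convex_simple[of _ UNIV] holomorphic_intros) auto
      moreover have "w ^ (l - Suc k) = w ^ l / w ^ Suc k" if "w \<in> path_image \<gamma>2" for w
        using \<gamma>2_nz[OF that] False by (simp add: power_diff del: power_Suc)
      ultimately have "((\<lambda>w. w ^ l / w ^ Suc k) has_contour_integral 0) \<gamma>2"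
        by (rule has_contour_integral_eq)
      then show ?thesis using False by simp
    qed
    from has_contour_integral_unique[OF 1 this] show ?thesis
      using 3 unfolding phi_term_def times_divide_eq_right
      by (simp flip: diff_divide_distrib)
  qed
qed


section \<open>The candidate for the inverse\<close>

text \<open>The negative of the correlation kernel, absorbing the leading minus sign of the formula
  for the inverse.\<close>

definition coupling :: "nat \<Rightarrow> nat \<Rightarrow> nat \<Rightarrow> nat \<Rightarrow> complex" where
  "coupling s j r l = phi_term s j r l - tilde_term s j r l"

lemma coupling_0: "coupling s 0 r l = 0"
  by (simp add: coupling_def phi_term_0 tilde_term_0)

lemma coupling_Suc_n: "r \<le> n \<Longrightarrow> s \<le> n \<Longrightarrow> l \<le> n \<Longrightarrow> coupling s (Suc n) r l = 0"
  by (simp add: coupling_def tilde_term_Suc_n)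

lemma coupling_recurrence:
  assumes "s < n"
  shows "coupling (Suc s) (Suc k) r l - coupling s k r l
    - A * coupling (Suc s) k r l - A * coupling s (Suc k) r l = (if r = Suc s \<and> l = k then 1 else 0)"
  using phi_term_recurrence[of s k r l] tilde_term_recurrence[OF assms, of k r l]
  unfolding coupling_def by (simp add: algebra_simps)

text \<open>The right-hand side of the theorem on all pairs of lattice points, so that it can be
  evaluated at neighbours outside the diamond.\<close>

definition inv_entry :: "vertex \<Rightarrow> vertex \<Rightarrow> complex" where
  "inv_entry x y = - neg_one_pow_quarter (fst x - snd x + fst y - snd y + 2) *
     corr_kernel a n \<gamma> \<gamma>1 \<gamma>2 (snd y) ((snd y - fst y + 1) div 2) (snd x) ((snd x - fst x + 1) div 2)"

text \<open>There is no bound on \<open>j\<close>, so the outside columns j = 0 and j = n + 1 are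
  covered.\<close>

lemma inv_entry_eq:
  assumes "1 \<le> r" "r \<le> n" "s \<le> n"
  shows "inv_entry (2 * int j - 1, 2 * int s) (2 * int l, 2 * int r - 1)
    = \<i> powi (int j - int s + int l - int r + 1) * coupling s j r l"
proof -
  have 1: "(2 * int j - 1 - 2 * int s + 2 * int l - (2 * int r - 1) + 2) div 2
      = int j - int s + int l - int r + 1"
    and 2: "(2 * int r - 1 - 2 * int l + 1) div 2 = int r - int l"
    and 3: "(2 * int s - (2 * int j - 1) + 1) div 2 = int s - int j + 1" by presburger+
  show ?thesis
    unfolding inv_entry_def fst_conv snd_conv neg_one_pow_quarter_def 1 2 3 corr_kernel_def
      kernel_tilde_eq[OF assms] kernel_phi_eq coupling_def by (simp add: algebra_simps)
qed

end

section \<open>The Kasteleyn matrix\<close>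

lemma white_vertex_cases:
  assumes "(x1, x2) \<in> white_vertices n"
  obtains j s where "x1 = 2 * int j - 1" "x2 = 2 * int s" "1 \<le> j" "j \<le> n" "s \<le> n"
proof -
  from assms have "x1 = 2 * int (nat ((x1 + 1) div 2)) - 1" "x2 = 2 * int (nat (x2 div 2))"
    "1 \<le> nat ((x1 + 1) div 2)" "nat ((x1 + 1) div 2) \<le> n" "nat (x2 div 2) \<le> n"
    unfolding white_vertices_def by (auto elim!: evenE oddE)
  then show ?thesis by (rule that)
qed

lemma black_vertex_cases:
  assumes "(y1, y2) \<in> black_vertices n"
  obtains l r where "y1 = 2 * int l" "y2 = 2 * int r - 1" "l \<le> n" "1 \<le> r" "r \<le> n"
proof -
  from assms have "y1 = 2 * int (nat (y1 div 2))" "y2 = 2 * int (nat ((y2 + 1) div 2)) - 1"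
    "nat (y1 div 2) \<le> n" "1 \<le> nat ((y2 + 1) div 2)" "nat ((y2 + 1) div 2) \<le> n"
    unfolding black_vertices_def by (auto elim!: evenE oddE)
  then show ?thesis by (rule that)
qed

lemma white_vertices_iff:
  "(2 * int j - 1, 2 * int s) \<in> white_vertices n \<longleftrightarrow> 1 \<le> j \<and> j \<le> n \<and> s \<le> n"
  unfolding white_vertices_def by auto

lemma finite_white_vertices: "finite (white_vertices n)"
  by (rule finite_subset[of _ "{1..2 * int n} \<times> {0..2 * int n}"]) (auto simp: white_vertices_def)

text \<open>Reflection in the diagonal exchanges the colours, which makes the Kasteleyn matrix
  square.\<close>

lemma bij_betw_swap_vertices: "bij_betw prod.swap (white_vertices n) (black_vertices n)"
  by (rule bij_betwI[of _ _ _ prod.swap]) (auto simp: white_vertices_def black_vertices_def)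

lemma finite_black_vertices: "finite (black_vertices n)"
  and card_black_vertices: "card (black_vertices n) = card (white_vertices n)"
  using bij_betw_finite[OF bij_betw_swap_vertices] bij_betw_same_card[OF bij_betw_swap_vertices]
    finite_white_vertices by auto

lemma kasteleyn_neighbour:
  "kasteleyn a b (b + e1) = kasteleyn_sign 0 b"
  "kasteleyn a b (b - e1) = - kasteleyn_sign 0 b"
  "kasteleyn a b (b - e2) = kasteleyn_sign 0 b * of_real a * \<i>"
  "kasteleyn a b (b + e2) = - kasteleyn_sign 0 b * of_real a * \<i>"
  by (cases b; simp add: kasteleyn_def e1_def e2_def kasteleyn_sign_def power_int_add)+

text \<open>If \<open>f\<close> vanishes at the neighbours missing from the graph, they may be added
  to the sum, and boundary rows look like interior ones.\<close>

lemma kasteleyn_row_sum: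
  assumes "\<And>x. x \<in> {b + e1, b - e1, b + e2, b - e2} - white_vertices n \<Longrightarrow> f x = 0"
  shows "(\<Sum>x\<in>white_vertices n. kasteleyn a b x * f x) =
    kasteleyn_sign 0 b * (f (b + e1) - f (b - e1)
      + of_real a * \<i> * f (b - e2) - of_real a * \<i> * f (b + e2))"
proof -
  have "(\<Sum>x\<in>white_vertices n. kasteleyn a b x * f x) =
      (\<Sum>x\<in>white_vertices n \<inter> {b + e1, b - e1, b + e2, b - e2}. kasteleyn a b x * f x)"
    by (intro sum.mono_neutral_right finite_white_vertices) (auto simp: kasteleyn_def)
  also have "\<dots> = (\<Sum>x\<in>{b + e1, b - e1, b + e2, b - e2}. kasteleyn a b x * f x)"
    using assms by (intro sum.mono_neutral_left) auto
  also have "\<dots> = kasteleyn a b (b + e1) * f (b + e1) + kasteleyn a b (b - e1) * f (b - e1)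
      + kasteleyn a b (b + e2) * f (b + e2) + kasteleyn a b (b - e2) * f (b - e2)"
    by (cases b) (simp add: e1_def e2_def)
  finally show ?thesis
    unfolding kasteleyn_neighbour by (simp add: algebra_simps)
qed

text \<open>Up to a common phase, the powers of \<open>\<i>\<close> in the entries and in the matrix
  turn the row sum into the left side of \<open>coupling_recurrence\<close>.\<close>

lemma (in kernel_contours) kasteleyn_inv_entry:
  assumes "b \<in> black_vertices n" "y \<in> black_vertices n"
  shows "(\<Sum>x\<in>white_vertices n. kasteleyn a b x * inv_entry x y) = (if b = y then 1 else 0)"
proof -
  \<comment> \<open>With \<open>Suc t\<close> for the row index, the neighbours of \<open>b\<close>
    have s = t or t + 1 and j = k or k + 1.\<close>
  obtain k t where b: "b = (2 * int k, 2 * int (Suc t) - 1)" and kt: "k \<le> n" "Suc t \<le> n"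
    using assms(1) by (cases b) (metis black_vertex_cases Suc_le_D One_nat_def)
  obtain l r where y: "y = (2 * int l, 2 * int r - 1)" and lr: "l \<le> n" "1 \<le> r" "r \<le> n"
    using assms(2) by (cases y) (metis black_vertex_cases)
  have nb: "b + e1 = (2 * int (Suc k) - 1, 2 * int (Suc t))" "b - e1 = (2 * int k - 1, 2 * int t)"
    "b + e2 = (2 * int k - 1, 2 * int (Suc t))" "b - e2 = (2 * int (Suc k) - 1, 2 * int t)"
    by (simp_all add: b e1_def e2_def)
  have entry: "inv_entry (2 * int j - 1, 2 * int s) y
      = \<i> powi (int j - int s + int l - int r + 1) * coupling s j r l" if "s \<le> n" for s j
    unfolding y using lr that by (intro inv_entry_eq) auto
  have zero: "inv_entry (2 * int j - 1, 2 * int s) y = 0"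
    if "(2 * int j - 1, 2 * int s) \<notin> white_vertices n" "s \<le> n" "j \<le> Suc n" for s j
  proof -
    \<comment> \<open>Since \<open>s \<le> n\<close>, a neighbour can leave the diamond only to the
      left or to the right.\<close>
    have "j = 0 \<or> j = Suc n" using that unfolding white_vertices_iff by auto
    then show ?thesis
      using that lr by (auto simp: entry coupling_0 coupling_Suc_n)
  qed
  define E where "E = \<i> powi (int k - int t + int l - int r + 1)"
  have E: "\<i> powi (int (Suc k) - int (Suc t) + int l - int r + 1) = E"
    "\<i> powi (int k - int (Suc t) + int l - int r + 1) = - \<i> * E"
    "\<i> powi (int (Suc k) - int t + int l - int r + 1) = \<i> * E"
  proof -
    have 1: "int (Suc k) - int (Suc t) + int l - int r + 1 = int k - int t + int l - int r + 1"
      and 2: "int k - int (Suc t) + int l - int r + 1 = (int k - int t + int l - int r + 1) - 1"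
      and 3: "int (Suc k) - int t + int l - int r + 1 = (int k - int t + int l - int r + 1) + 1" by auto
    show "\<i> powi (int (Suc k) - int (Suc t) + int l - int r + 1) = E"
      unfolding 1 E_def ..
    show "\<i> powi (int k - int (Suc t) + int l - int r + 1) = - \<i> * E"
      unfolding 2 E_def by (subst power_int_diff) auto
    show "\<i> powi (int (Suc k) - int t + int l - int r + 1) = \<i> * E"
      unfolding 3 E_def by (subst power_int_add) auto
  qed
  have "(\<Sum>x\<in>white_vertices n. kasteleyn a b x * inv_entry x y) =
    kasteleyn_sign 0 b * (inv_entry (b + e1) y - inv_entry (b - e1) y
      + A * \<i> * inv_entry (b - e2) y - A * \<i> * inv_entry (b + e2) y)"
  proof (rule kasteleyn_row_sum)
    fix x assume "x \<in> {b + e1, b - e1, b + e2, b - e2} - white_vertices n"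
    then show "inv_entry x y = 0"
      unfolding nb using kt by (auto intro!: zero simp del: of_nat_Suc)
  qed
  \<comment> \<open>The relative phases \<open>\<i>\<close> and \<open>- \<i>\<close> at the two
    \<open>e2\<close> neighbours meet opposite signs in the row sum, so both coefficients become
    -a.\<close>
  also have "\<dots> = kasteleyn_sign 0 b * E * (coupling (Suc t) (Suc k) r l - coupling t k r l
      - A * coupling (Suc t) k r l - A * coupling t (Suc k) r l)"
    unfolding nb entry[OF kt(2)] entry[OF Suc_leD[OF kt(2)]] E E_def[symmetric]
    by (simp add: algebra_simps)
  also have "\<dots> = kasteleyn_sign 0 b * E * (if r = Suc t \<and> l = k then 1 else 0)"
    using kt by (subst coupling_recurrence) auto
  also have "\<dots> = (if b = y then 1 else 0)"
  proof (cases "r = Suc t \<and> l = k")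
    \<comment> \<open>On the diagonal E = (-1)^(k - t) and the Kasteleyn sign is (-1)^(k + t), with
      product 1.\<close>
    case True
    then have "int k - int t + int l - int r + 1 = 2 * (int k - int t)" by simp
    then have "E = (-1) powi (int k - int t)"
      unfolding E_def by (simp only: power_int_mult) simp
    moreover have "kasteleyn_sign 0 b = (-1) powi (int k + int t)"
    proof -
      have "0 + (2 * int k + (2 * int (Suc t) - 1) - 1) div 2 = int k + int t" by simp
      then show ?thesis unfolding kasteleyn_sign_def b fst_conv snd_conv by (rule arg_cong)
    qed
    ultimately have "kasteleyn_sign 0 b * E = (-1) powi (2 * int k)"
      by (simp flip: power_int_add)
    then show ?thesis using True by (simp add: b y power_int_mult)
  next
    case False
    then show ?thesis by (auto simp: b y)
  qed
  finally show ?thesis .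
qed

section \<open>Inverses\<close>

text \<open>Enumerations of \<open>R\<close> and \<open>C\<close> turn the families into square
  matrices over a field, where a right inverse is also a left inverse.\<close>

lemma is_inverse_on_right_inverse:
  assumes "finite R" "finite C" "card R = card C"
    and right: "\<And>i j. i \<in> R \<Longrightarrow> j \<in> R \<Longrightarrow> (\<Sum>k\<in>C. M i k * L k j) = (if i = j then 1 else 0)"
  shows "is_inverse_on R C M L"
proof -
  define m where "m = card C"
  obtain f where f: "bij_betw f {0..<m} R"
    using ex_bij_betw_nat_finite[OF assms(1)] assms(3) m_def by auto
  obtain g where g: "bij_betw g {0..<m} C"
    using ex_bij_betw_nat_finite[OF assms(2)] m_def by auto
  define P where "P = mat m m (\<lambda>(i, j). M (f i) (g j))"
  define Q where "Q = mat m m (\<lambda>(i, j). L (g i) (f j))"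
  have PQ: "P \<in> carrier_mat m m" "Q \<in> carrier_mat m m" by (auto simp: P_def Q_def)
  have "P * Q = 1\<^sub>m m"
  proof (rule eq_matI)
    fix i j assume "i < dim_row (1\<^sub>m m :: complex mat)" "j < dim_col (1\<^sub>m m :: complex mat)"
    then have ij: "i < m" "j < m" by auto
    have "(P * Q) $$ (i, j) = (\<Sum>k\<in>{0..<m}. M (f i) (g k) * L (g k) (f j))"
      using ij by (simp add: P_def Q_def scalar_prod_def)
    also have "\<dots> = (\<Sum>k\<in>C. M (f i) k * L k (f j))"
      by (rule sum.reindex_bij_betw[OF g])
    also have "\<dots> = (if f i = f j then 1 else 0)"
      using f ij by (intro right) (auto simp: bij_betw_def)
    also have "f i = f j \<longleftrightarrow> i = j"
      using f ij by (auto simp: bij_betw_def inj_on_def)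
    finally show "(P * Q) $$ (i, j) = 1\<^sub>m m $$ (i, j)" using ij by simp
  qed (auto simp: P_def Q_def)
  with PQ have QP: "Q * P = 1\<^sub>m m" by (rule mat_mult_left_right_inverse)
  have "(\<Sum>k\<in>R. L i k * M k j) = (if i = j then 1 else 0)" if "i \<in> C" "j \<in> C" for i j
  proof -
    from that g obtain i' j' where ij: "i = g i'" "j = g j'" "i' < m" "j' < m"
      by (auto simp: bij_betw_def)
    have "(\<Sum>k\<in>R. L i k * M k j) = (\<Sum>k\<in>{0..<m}. L i (f k) * M (f k) j)"
      by (rule sum.reindex_bij_betw[OF f, symmetric])
    also have "\<dots> = (Q * P) $$ (i', j')"
      using ij by (simp add: P_def Q_def scalar_prod_def)
    also have "\<dots> = (if i' = j' then 1 else 0)" using ij by (simp add: QP)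
    also have "i' = j' \<longleftrightarrow> i = j" using g ij by (auto simp: bij_betw_def inj_on_def)
    finally show ?thesis .
  qed
  with right show ?thesis unfolding is_inverse_on_def by blast
qed

text \<open>The chosen N is a two-sided inverse because one exists, and N = N (M L) = (N M) L = L on
  the index sets.\<close>

lemma matrix_inv_on_eq:
  assumes "finite R" "finite C" and L: "is_inverse_on R C M L" and "i \<in> C" "j \<in> R"
  shows "matrix_inv_on R C M i j = L i j"
proof -
  define N where "N = matrix_inv_on R C M"
  have N: "is_inverse_on R C M N"
    unfolding N_def matrix_inv_on_def using L by (rule someI[of "is_inverse_on R C M"])
  have "N i j = (\<Sum>k\<in>R. N i k * (if k = j then 1 else 0))"
    using assms by (simp add: sum.delta if_distrib cong: if_cong)
  also have "\<dots> = (\<Sum>k\<in>R. N i k * (\<Sum>c\<in>C. M k c * L c j))"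
    using L \<open>j \<in> R\<close> unfolding is_inverse_on_def by (intro sum.cong) auto
  also have "\<dots> = (\<Sum>c\<in>C. (\<Sum>k\<in>R. N i k * M k c) * L c j)"
    unfolding sum_distrib_left sum_distrib_right by (subst sum.swap) (simp add: mult.assoc)
  also have "\<dots> = (\<Sum>c\<in>C. (if i = c then 1 else 0) * L c j)"
    using N \<open>i \<in> C\<close> unfolding is_inverse_on_def by (intro sum.cong) auto
  also have "\<dots> = L i j"
    using assms by (simp add: mult_delta_left)
  finally show ?thesis by (simp add: N_def)
qed

theorem proposition2p4:
  fixes a :: real and n :: nat and \<gamma> \<gamma>1 \<gamma>2 :: "real \<Rightarrow> complex"
  assumes "a > 0" and "n \<ge> 1"
    and "admissible_contours a \<gamma> \<gamma>1 \<gamma>2"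
  shows "invertible_on (black_vertices n) (white_vertices n) (kasteleyn a) \<and>
    (\<forall>x1 x2 y1 y2. (x1, x2) \<in> white_vertices n \<longrightarrow> (y1, y2) \<in> black_vertices n \<longrightarrow>
       kasteleyn_inv n a (x1, x2) (y1, y2) =
         - neg_one_pow_quarter (x1 - x2 + y1 - y2 + 2) *
           corr_kernel a n \<gamma> \<gamma>1 \<gamma>2 y2 ((y2 - y1 + 1) div 2) x2 ((x2 - x1 + 1) div 2))"
proof -
  interpret kernel_contours a n \<gamma> \<gamma>1 \<gamma>2 using assms by unfold_locales
  have inv: "is_inverse_on (black_vertices n) (white_vertices n) (kasteleyn a) inv_entry"
    by (intro is_inverse_on_right_inverse finite_black_vertices finite_white_vertices
        card_black_vertices kasteleyn_inv_entry)
  from matrix_inv_on_eq[OF finite_black_vertices finite_white_vertices this]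
  have "kasteleyn_inv n a x y = inv_entry x y"
    if "x \<in> white_vertices n" "y \<in> black_vertices n" for x y
    using that by (simp add: kasteleyn_inv_def)
  with inv show ?thesis
    unfolding invertible_on_def by (auto simp: inv_entry_def)
qed

end
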